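(* Let $d\ge1$ and suppose $\mu$ is a positive finite Borel measure on $\mathbb{C}^d$ with compact support $K$. Given an integer $m>0$, there exist $N\le\dim(\mathbb{C}_{m,d}[z,\bar z]|_K)$, nodes $z_1,\dots,z_N$ in $K$, and positive weights $\rho_1,\dots,\rho_N$ such that $$\int_K p(z,\bar z)\,d\mu(z)=\sum_{i=1}^{N}\rho_i\,p(z_i,\bar z_i)\qquad\text{for all } p\in\mathbb{C}_{m,d}[z,\bar z].$$
   Context: $\mathbb{C}_{m,d}[z,\bar z]$ is the space of complex polynomials $p(z,\bar z)$ in $z=(z_1,\dots,z_d)$ and $\bar z=(\bar z_1,\dots,\bar z_d)$ of total degree at most $m$ (i.e., the span of the monomials $\bar z^iz^j$, $i,j\in\mathbb{Z}_+^d$, $|i|+|j|\le m$). $\mathbb{C}_{m,d}[z,\bar z]|_K$ is the vector space of restrictions to $K$ of these polynomials. *)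

theory Defs
  imports "HOL-Analysis.Analysis" "HOL-Library.Function_Algebras"
begin

definition measure_support :: "'a::topological_space measure \<Rightarrow> 'a set" where
  "measure_support M = {x. \<forall>U. open U \<longrightarrow> x \<in> U \<longrightarrow> emeasure M U > 0}"

definition cscale :: "complex \<Rightarrow> ('a \<Rightarrow> complex) \<Rightarrow> 'a \<Rightarrow> complex" where
  "cscale c f = (\<lambda>x. c * f x)"

(* The library's real vector space constants span and dim do not apply here:
   span and dimension are taken over the complex numbers. *)
global_interpretation cfun: vector_space "cscale :: complex \<Rightarrow> ('a \<Rightarrow> complex) \<Rightarrow> 'a \<Rightarrow> complex"
  by unfold_locales (auto simp: cscale_def fun_eq_iff algebra_simps)

definition mixed_monomial :: "('d::finite \<Rightarrow> nat) \<Rightarrow> ('d \<Rightarrow> nat) \<Rightarrow> complex ^ 'd \<Rightarrow> complex" where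
  "mixed_monomial i j z = (\<Prod>k\<in>UNIV. cnj (z $ k) ^ i k) * (\<Prod>k\<in>UNIV. (z $ k) ^ j k)"

(* A polynomial p(z, cnj z) is identified with the function it defines on complex d-space;
   distinct coefficient families define distinct functions. *)
definition mixed_polys :: "nat \<Rightarrow> (complex ^ 'd::finite \<Rightarrow> complex) set" where
  "mixed_polys m = cfun.span {mixed_monomial i j | i j. (\<Sum>k\<in>UNIV. i k) + (\<Sum>k\<in>UNIV. j k) \<le> m}"

(* The functions on K are represented by their extensions by zero, so that the restrictions
   again form a subspace (with an arbitrary default value outside K they would not). *)
definition restrict_to :: "'a set \<Rightarrow> ('a \<Rightarrow> complex) \<Rightarrow> 'a \<Rightarrow> complex" where
  "restrict_to K f = (\<lambda>x. if x \<in> K then f x else 0)"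

end

theory Submission
  imports Defs
begin

text \<open>
  Let \<open>n\<close> be the dimension of the space of restrictions and \<open>L\<close> integration over \<open>K\<close>.  Cutting \<open>K\<close>
  into small pieces approximates \<open>L\<close> on a basis by nonnegative combinations of point evaluations
  in \<open>K\<close>.  Point evaluations at more than \<open>n\<close> points are linearly dependent, so Caratheodory's
  elimination for cones reduces each such combination to \<open>n\<close> nodes without changing its values.
  As the constant 1 belongs to the space, the weights still sum to \<open>\<mu>(K)\<close>; hence nodes and
  weights range over a compact set, where the error functional attains its infimum 0.
\<close>

section \<open>Pointwise calculus in the complex vector space of functions\<close>

lemma sum_fun_apply:
  fixes f :: "'i \<Rightarrow> 'a \<Rightarrow> 'b::comm_monoid_add"
  shows "(\<Sum>i\<in>I. f i) x = (\<Sum>i\<in>I. f i x)"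
  by (induction I rule: infinite_finite_induct) auto

lemma cfun_subspace_pointwise:
  assumes "cfun.subspace S"
  shows "f \<in> S \<Longrightarrow> g \<in> S \<Longrightarrow> (\<lambda>x. f x + g x) \<in> S"
    and "f \<in> S \<Longrightarrow> (\<lambda>x. c * f x) \<in> S"
  using cfun.subspace_add[OF assms, of f g] cfun.subspace_scale[OF assms, of f c]
  by (simp_all add: plus_fun_def cscale_def)

lemma cfun_subspaceI:
  assumes "(\<lambda>x. 0) \<in> S"
    and "\<And>f g. f \<in> S \<Longrightarrow> g \<in> S \<Longrightarrow> (\<lambda>x. f x + g x) \<in> S"
    and "\<And>c f. f \<in> S \<Longrightarrow> (\<lambda>x. c * f x) \<in> S"
  shows "cfun.subspace S"
  using assms unfolding cfun.subspace_def by (simp add: zero_fun_def plus_fun_def cscale_def)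

section \<open>Linear relations among point evaluations\<close>

text \<open>Evaluating all members of \<open>B\<close> at a point gives a vector with
  \<open>card B\<close> coordinates, and more vectors than coordinates are linearly
  dependent.\<close>

lemma exists_evaluation_relation:
  fixes B :: "('a \<Rightarrow> complex) set"
  assumes "finite B" "finite C" "card B < card C"
  shows "\<exists>s. (\<exists>c\<in>C. s c \<noteq> 0) \<and> (\<forall>b\<in>B. (\<Sum>c\<in>C. s c * b c) = 0)"
proof -
  \<comment> \<open>Coordinate vectors indexed by \<open>B\<close> are encoded as functions
    vanishing off \<open>B\<close>, so that dimension theory for \<open>cfun\<close> applies to
    them; the \<open>e b\<close> are the unit vectors.\<close>
  define v where "v c = (\<lambda>b. if b \<in> B then b c else 0 :: complex)" for c
  define e :: "('a \<Rightarrow> complex) \<Rightarrow> ('a \<Rightarrow> complex) \<Rightarrow> complex"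
    where "e b = (\<lambda>b'. if b' = b then 1 else 0)" for b
  show ?thesis
  proof (cases "inj_on v C")
    case False
    then obtain c d where cd: "c \<in> C" "d \<in> C" "c \<noteq> d" "v c = v d"
      by (auto simp: inj_on_def)
    define s where "s x = (if x = c then 1 else if x = d then -1 else 0 :: complex)" for x
    have "(\<Sum>x\<in>C. s x * b x) = 0" if "b \<in> B" for b
    proof -
      have "(\<Sum>x\<in>C. s x * b x) = (\<Sum>x\<in>{c,d}. s x * b x)"
        using cd assms(2) by (intro sum.mono_neutral_right) (auto simp: s_def)
      also have "\<dots> = b c - b d" using cd by (simp add: s_def)
      also have "\<dots> = 0" using fun_cong[OF cd(4), of b] that by (simp add: v_def)
      finally show ?thesis .
    qed
    moreover have "s c \<noteq> 0" by (simp add: s_def)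
    ultimately show ?thesis using cd(1) by blast
  next
    case True
    have "v c \<in> cfun.span (e ` B)" for c
    proof -
      have "v c = (\<Sum>b\<in>B. cscale (b c) (e b))"
        using assms(1) by (intro ext) (simp add: v_def e_def cscale_def sum_fun_apply if_distrib cong: if_cong)
      then show ?thesis
        by (simp add: cfun.span_sum cfun.span_scale cfun.span_base)
    qed
    then have "v ` C \<subseteq> cfun.span (e ` B)" by auto
    moreover have "card (e ` B) < card (v ` C)"
      using card_image_le[OF assms(1), of e] assms(3) by (simp add: card_image[OF True])
    ultimately have "cfun.dependent (v ` C)"
      using cfun.independent_span_bound[of "e ` B" "v ` C"] assms(1) by auto
    then obtain u where u: "\<exists>w\<in>v ` C. u w \<noteq> 0" "(\<Sum>w\<in>v ` C. cscale (u w) w) = 0"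
      using cfun.dependent_finite[of "v ` C"] assms(2) by auto
    have *: "(\<Sum>c\<in>C. cscale (u (v c)) (v c)) = 0"
      using u(2) by (simp add: sum.reindex[OF True])
    have "(\<Sum>c\<in>C. u (v c) * b c) = 0" if "b \<in> B" for b
      using fun_cong[OF *, of b] that by (simp add: sum_fun_apply cscale_def v_def)
    then show ?thesis using u(1) by (intro exI[of _ "\<lambda>c. u (v c)"]) auto
  qed
qed

text \<open>
  Since the span is closed under conjugation, the conjugate of a relation is again a relation,
  and so are its real and imaginary parts; complex dimension thus bounds real node counts.
\<close>

lemma exists_real_evaluation_relation:
  fixes B :: "('a \<Rightarrow> complex) set"
  assumes "finite B" "finite C" "card B < card C"
    and cnj: "\<And>b. b \<in> B \<Longrightarrow> (\<lambda>x. cnj (b x)) \<in> cfun.span B"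
  shows "\<exists>s :: 'a \<Rightarrow> real. (\<exists>c\<in>C. s c > 0) \<and>
    (\<forall>f\<in>cfun.span B. (\<Sum>c\<in>C. complex_of_real (s c) * f c) = 0)"
proof -
  obtain s where s: "\<exists>c\<in>C. s c \<noteq> 0" "\<And>b. b \<in> B \<Longrightarrow> (\<Sum>c\<in>C. s c * b c) = 0"
    using exists_evaluation_relation[OF assms(1-3)] by blast
  \<comment> \<open>For fixed coefficients the functions annihilated by the relation form a
    subspace, so checking \<open>B\<close> suffices.\<close>
  have span_zero: "f \<in> cfun.span B \<Longrightarrow> (\<Sum>c\<in>C. r c * f c) = 0"
    if "\<And>b. b \<in> B \<Longrightarrow> (\<Sum>c\<in>C. r c * b c) = 0" for r f
  proof -
    have "cfun.subspace {f. (\<Sum>c\<in>C. r c * f c) = 0}"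
      by (rule cfun_subspaceI)
        (auto simp: algebra_simps sum.distrib simp flip: sum_distrib_left)
    then have "cfun.span B \<subseteq> {f. (\<Sum>c\<in>C. r c * f c) = 0}"
      using that by (intro cfun.span_minimal) auto
    then show "f \<in> cfun.span B \<Longrightarrow> (\<Sum>c\<in>C. r c * f c) = 0" by auto
  qed
  \<comment> \<open>The original relation is applied to the conjugate of \<open>b\<close>, which
    lies in the span, and the result is conjugated.\<close>
  have s': "(\<Sum>c\<in>C. cnj (s c) * b c) = 0" if "b \<in> B" for b
  proof -
    have "(\<Sum>c\<in>C. s c * cnj (b c)) = 0" using span_zero[OF s(2) cnj[OF that]] by simp
    then have "cnj (\<Sum>c\<in>C. s c * cnj (b c)) = 0" by simp
    then show ?thesis by simp
  qed
  have Re: "(\<Sum>c\<in>C. complex_of_real (Re (s c)) * b c) = 0" if "b \<in> B" for b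
  proof -
    have "(\<Sum>c\<in>C. complex_of_real (Re (s c)) * b c)
        = ((\<Sum>c\<in>C. s c * b c) + (\<Sum>c\<in>C. cnj (s c) * b c)) / 2"
      unfolding sum.distrib[symmetric] sum_divide_distrib
      by (intro sum.cong refl) (simp add: complex_eq_iff field_simps)
    then show ?thesis using s(2) s' that by simp
  qed
  have im: "complex_of_real (Im w) = (w - cnj w) / (2 * \<i>)" for w
    by (simp add: complex_eq_iff Re_divide Im_divide)
  have Im: "(\<Sum>c\<in>C. complex_of_real (Im (s c)) * b c) = 0" if "b \<in> B" for b
  proof -
    have "(\<Sum>c\<in>C. complex_of_real (Im (s c)) * b c)
        = ((\<Sum>c\<in>C. s c * b c) - (\<Sum>c\<in>C. cnj (s c) * b c)) / (2 * \<i>)"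
      unfolding sum_subtractf[symmetric] sum_divide_distrib
      by (intro sum.cong refl) (simp only: im left_diff_distrib times_divide_eq_left)
    then show ?thesis using s(2) s' that by simp
  qed
  \<comment> \<open>A nonzero complex coefficient has a nonzero real or imaginary part, so one of
    the two real relations is nontrivial.\<close>
  obtain r :: "'a \<Rightarrow> real" where r: "\<exists>c\<in>C. r c \<noteq> 0"
    "\<And>b. b \<in> B \<Longrightarrow> (\<Sum>c\<in>C. complex_of_real (r c) * b c) = 0"
  proof (cases "\<exists>c\<in>C. Re (s c) \<noteq> 0")
    case True
    then show ?thesis using that[of "\<lambda>c. Re (s c)"] Re by blast
  next
    case False
    then have "\<exists>c\<in>C. Im (s c) \<noteq> 0" using s(1) by (auto simp: complex_eq_iff)
    then show ?thesis using that[of "\<lambda>c. Im (s c)"] Im by blast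
  qed
  note r0 = span_zero[of "\<lambda>c. complex_of_real (r c)", OF r(2)]
  \<comment> \<open>The elimination of a node needs a positive coefficient; if there is none, the
    negated relation has one.\<close>
  show ?thesis
  proof (cases "\<exists>c\<in>C. r c > 0")
    case True
    then show ?thesis using r0 by blast
  next
    case False
    then have "\<exists>c\<in>C. - r c > 0" using r(1) by force
    then show ?thesis using r0 by (intro exI[of _ "\<lambda>c. - r c"]) (auto simp: sum_negf)
  qed
qed


section \<open>Caratheodory elimination of nodes\<close>

text \<open>While there are more than \<open>card B\<close> nodes, a multiple of a real relation can
  be subtracted from the weights: no value on the span changes, and the multiple is chosen so that
  one weight vanishes and none turns negative. Induction on the number of nodes does the
  rest.\<close>

lemma reduce_quadrature:
  fixes B :: "('a \<Rightarrow> complex) set" and \<rho> :: "'a \<Rightarrow> real"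
  assumes "finite B" "finite C"
    and "\<And>b. b \<in> B \<Longrightarrow> (\<lambda>x. cnj (b x)) \<in> cfun.span B"
    and "\<And>c. c \<in> C \<Longrightarrow> \<rho> c \<ge> 0"
  shows "\<exists>D \<sigma>. D \<subseteq> C \<and> card D \<le> card B \<and> (\<forall>c\<in>D. \<sigma> c \<ge> (0::real)) \<and>
    (\<forall>f\<in>cfun.span B. (\<Sum>c\<in>D. complex_of_real (\<sigma> c) * f c)
      = (\<Sum>c\<in>C. complex_of_real (\<rho> c) * f c))"
  using assms(2,4)
proof (induction "card C" arbitrary: C \<rho> rule: less_induct)
  case less
  show ?case
  proof (cases "card C \<le> card B")
    case True
    then show ?thesis using less.prems by blast
  next
    case False
    then obtain s where s: "\<exists>c\<in>C. s c > 0"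
      "\<And>f. f \<in> cfun.span B \<Longrightarrow> (\<Sum>c\<in>C. complex_of_real (s c) * f c) = 0"
      using exists_real_evaluation_relation[of B C] assms(1,3) less.prems(1) by force
    define P where "P = {c\<in>C. s c > 0}"
    define q where "q c = \<rho> c / s c" for c
    have P: "finite P" "P \<noteq> {}" using s(1) less.prems(1) by (auto simp: P_def)
    \<comment> \<open>The least ratio \<open>q d\<close> is the largest admissible multiple: the
      weight at \<open>d\<close> reaches zero first. Nodes outside \<open>P\<close> impose no bound,
      since their weights do not decrease.\<close>
    obtain d where d: "d \<in> P" "\<And>c. c \<in> P \<Longrightarrow> q d \<le> q c"
      using ex_min_if_finite[of "q ` P"] P by (metis (no_types, lifting) finite_imageI image_is_empty image_iff not_less)
    define \<sigma> where "\<sigma> c = \<rho> c - q d * s c" for c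
    have dC: "d \<in> C" and "s d > 0" using d(1) by (auto simp: P_def)
    have qd: "q d \<ge> 0" using less.prems(2)[OF dC] \<open>s d > 0\<close> by (simp add: q_def)
    have \<sigma>d: "\<sigma> d = 0" using \<open>s d > 0\<close> by (simp add: \<sigma>_def q_def)
    have \<sigma>0: "\<sigma> c \<ge> 0" if "c \<in> C" for c
    proof (cases "s c > 0")
      case True
      then have "q d \<le> \<rho> c / s c" using d(2)[of c] that by (simp add: P_def q_def)
      then show ?thesis using True by (simp add: \<sigma>_def field_simps)
    next
      case False
      then have "q d * s c \<le> 0" using qd by (simp add: mult_nonneg_nonpos)
      then show ?thesis using less.prems(2)[OF that] by (simp add: \<sigma>_def)
    qed
    have eq: "(\<Sum>c\<in>C - {d}. complex_of_real (\<sigma> c) * f c) = (\<Sum>c\<in>C. complex_of_real (\<rho> c) * f c)"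
      if "f \<in> cfun.span B" for f
    proof -
      have "(\<Sum>c\<in>C - {d}. complex_of_real (\<sigma> c) * f c) = (\<Sum>c\<in>C. complex_of_real (\<sigma> c) * f c)"
        using less.prems(1) \<sigma>d by (intro sum.mono_neutral_left) auto
      also have "\<dots> = (\<Sum>c\<in>C. complex_of_real (\<rho> c) * f c)
          - complex_of_real (q d) * (\<Sum>c\<in>C. complex_of_real (s c) * f c)"
        by (simp add: \<sigma>_def algebra_simps sum_subtractf sum_distrib_left)
      finally show ?thesis using s(2)[OF that] by simp
    qed
    have "card (C - {d}) < card C" using dC less.prems(1) by (intro psubset_card_mono) auto
    from less.hyps[OF this, of \<sigma>] less.prems(1) \<sigma>0
    obtain D \<tau> where "D \<subseteq> C - {d}" "card D \<le> card B" "\<forall>c\<in>D. \<tau> c \<ge> (0::real)"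
      "\<forall>f\<in>cfun.span B. (\<Sum>c\<in>D. complex_of_real (\<tau> c) * f c)
        = (\<Sum>c\<in>C - {d}. complex_of_real (\<sigma> c) * f c)"
      by auto
    with eq show ?thesis by (intro exI[of _ D] exI[of _ \<tau>]) auto
  qed
qed

section \<open>Approximating the integral by point masses\<close>

lemma set_integrable_continuous_compact:
  fixes f :: "'a::metric_space \<Rightarrow> complex"
  assumes "sets M = sets borel" "finite_measure M" "compact K" "continuous_on K f"
  shows "set_integrable M K f"
proof -
  interpret finite_measure M by fact
  have "compact (f ` K)" using assms by (simp add: compact_continuous_image)
  then obtain b where b: "\<And>x. x \<in> K \<Longrightarrow> norm (f x) \<le> b"
    using compact_imp_bounded bounded_iff by (metis imageI)
  have meas: "(\<lambda>x. indicator K x *\<^sub>R f x) \<in> borel_measurable M"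
    using borel_measurable_continuous_on_indicator[OF _ assms(4)] borel_compact[OF assms(3)]
      measurable_cong_sets[OF assms(1) refl] by blast
  show ?thesis
    unfolding set_integrable_def
  proof (rule integrable_const_bound[OF _ meas])
    show "AE x in M. norm (indicator K x *\<^sub>R f x) \<le> \<bar>b\<bar>"
      using b by (intro AE_I2) (force simp: indicator_def)
  qed
qed

text \<open>A Riemann sum over a disjoint partition cut out by the balls one at a time. The set
  \<open>A\<close> varies because the induction passes to the remainder outside one ball, which the
  other balls cover. The weights are the masses of the pieces, so the errors add up to at most
  \<open>\<epsilon>\<close> times the total mass.\<close>

lemma approximate_on_cover:
  fixes B :: "('a::metric_space \<Rightarrow> complex) set"
  assumes M: "sets M = sets borel" "finite_measure M"
    and int: "\<And>b. b \<in> B \<Longrightarrow> set_integrable M K b"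
    and close: "\<And>b x y. b \<in> B \<Longrightarrow> x \<in> K \<Longrightarrow> y \<in> K \<Longrightarrow> dist y x < \<delta> \<Longrightarrow> norm (b x - b y) \<le> \<epsilon>"
    and "finite C" "C \<subseteq> K" "A \<in> sets borel" "A \<subseteq> K" "A \<subseteq> (\<Union>c\<in>C. ball c \<delta>)"
  shows "\<exists>\<rho>. (\<forall>c\<in>C. \<rho> c \<ge> (0::real)) \<and> sum \<rho> C = measure M A \<and>
    (\<forall>b\<in>B. norm ((LINT x:A|M. b x) - (\<Sum>c\<in>C. complex_of_real (\<rho> c) * b c)) \<le> \<epsilon> * measure M A)"
  using assms(5-)
proof (induction C arbitrary: A rule: finite_induct)
  case empty
  then show ?case by (auto simp: set_lebesgue_integral_def)
next
  case (insert c C)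
  interpret finite_measure M by fact
  define A1 where "A1 = A \<inter> ball c \<delta>"
  define A2 where "A2 = A - ball c \<delta>"
  have A12: "A1 \<in> sets M" "A2 \<in> sets M" "A1 \<inter> A2 = {}" "A = A1 \<union> A2" "A1 \<subseteq> K" "A2 \<subseteq> K"
    using insert.prems M(1) by (auto simp: A1_def A2_def)
  have mA: "measure M A = measure M A1 + measure M A2"
    using A12 finite_measure_Union by metis
  have "C \<subseteq> K" "A2 \<subseteq> (\<Union>c\<in>C. ball c \<delta>)" using insert.prems by (auto simp: A2_def)
  with insert.IH[of A2] A12 M(1) obtain \<rho> where \<rho>: "\<forall>c\<in>C. \<rho> c \<ge> (0::real)" "sum \<rho> C = measure M A2"
    "\<And>b. b \<in> B \<Longrightarrow> norm ((LINT x:A2|M. b x) - (\<Sum>c\<in>C. complex_of_real (\<rho> c) * b c)) \<le> \<epsilon> * measure M A2"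
    by auto
  \<comment> \<open>The mass of the piece \<open>A1\<close> is concentrated at \<open>c\<close>; as
    \<open>c\<close> is not in \<open>C\<close>, the earlier weights survive the update.\<close>
  define \<sigma> where "\<sigma> = \<rho>(c := measure M A1)"
  have \<sigma>C: "(\<Sum>x\<in>C. complex_of_real (\<sigma> x) * b x) = (\<Sum>x\<in>C. complex_of_real (\<rho> x) * b x)" for b
    using insert.hyps by (intro sum.cong) (auto simp: \<sigma>_def)
  have \<sigma>C': "sum \<sigma> C = sum \<rho> C"
    using insert.hyps by (intro sum.cong) (auto simp: \<sigma>_def)
  have "norm ((LINT x:A|M. b x) - (\<Sum>c\<in>insert c C. complex_of_real (\<sigma> c) * b c)) \<le> \<epsilon> * measure M A"
    if "b \<in> B" for b
  proof -
    have i1: "set_integrable M A1 b" and i2: "set_integrable M A2 b"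
      using set_integrable_subset[OF int[OF that]] A12 by auto
    have i3: "set_integrable M A1 (\<lambda>x. b c)" and i4: "set_integrable M A1 (\<lambda>x. \<epsilon>)"
      using A12(1) by (auto simp: set_integrable_def less_top[symmetric])
    \<comment> \<open>On \<open>A1\<close> the function \<open>b\<close> stays within
      \<open>\<epsilon>\<close> of its value at the centre \<open>c\<close>, so the point mass costs
      at most \<open>\<epsilon>\<close> times the mass of \<open>A1\<close>.\<close>
    have "(LINT x:A1|M. b x) - complex_of_real (measure M A1) * b c = (LINT x:A1|M. b x - b c)"
      using set_integral_diff(2)[OF i1 i3] set_integral_const[of A1 M "b c"] A12(1)
      by (simp add: scaleR_conv_of_real emeasure_eq_measure)
    also have "norm \<dots> \<le> (LINT x:A1|M. norm (b x - b c))"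
      by (intro set_integral_norm_bound set_integral_diff i1 i3)
    also have "\<dots> \<le> (LINT x:A1|M. \<epsilon>)"
    proof (rule set_integral_mono)
      show "set_integrable M A1 (\<lambda>x. norm (b x - b c))"
        by (intro set_integrable_norm set_integral_diff i1 i3)
      show "norm (b x - b c) \<le> \<epsilon>" if "x \<in> A1" for x
        using that close[OF \<open>b \<in> B\<close>, of x c] A12(5) insert.prems(1) by (auto simp: A1_def)
    qed (rule i4)
    also have "\<dots> = \<epsilon> * measure M A1"
      using set_integral_const[of A1 M \<epsilon>] A12(1) by (simp add: emeasure_eq_measure)
    finally have 1: "norm ((LINT x:A1|M. b x) - complex_of_real (measure M A1) * b c) \<le> \<epsilon> * measure M A1" .
    have "(LINT x:A|M. b x) - (\<Sum>c\<in>insert c C. complex_of_real (\<sigma> c) * b c)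
      = ((LINT x:A1|M. b x) - complex_of_real (measure M A1) * b c)
      + ((LINT x:A2|M. b x) - (\<Sum>c\<in>C. complex_of_real (\<rho> c) * b c))"
      using set_integral_Un[OF A12(3) i1 i2] insert.hyps
      by (simp add: A12(4) \<sigma>C) (simp add: \<sigma>_def)
    also have "norm \<dots> \<le> \<epsilon> * measure M A1 + \<epsilon> * measure M A2"
      using norm_triangle_ineq 1 \<rho>(3)[OF that] by (meson add_mono order.trans)
    finally show ?thesis by (simp add: mA distrib_left)
  qed
  moreover have "sum \<sigma> (insert c C) = measure M A"
    using insert.hyps \<sigma>C' \<rho>(2) mA by (simp add: \<sigma>_def)
  moreover have "\<forall>x\<in>insert c C. \<sigma> x \<ge> 0" using \<rho>(1) by (auto simp: \<sigma>_def)
  ultimately show ?case by blast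
qed

lemma uniformly_close_finite_family:
  fixes B :: "('a::metric_space \<Rightarrow> complex) set"
  assumes "finite B" "compact K" "\<And>b. b \<in> B \<Longrightarrow> continuous_on K b" "\<epsilon> > 0"
  shows "\<exists>\<delta>>0. \<forall>b\<in>B. \<forall>x\<in>K. \<forall>y\<in>K. dist y x < \<delta> \<longrightarrow> norm (b x - b y) \<le> \<epsilon>"
  using assms(1,3)
proof (induction B rule: finite_induct)
  case empty
  show ?case by (auto intro: exI[of _ 1])
next
  case (insert b B)
  then obtain \<delta>1 where 1: "\<delta>1 > 0" "\<forall>b\<in>B. \<forall>x\<in>K. \<forall>y\<in>K. dist y x < \<delta>1 \<longrightarrow> norm (b x - b y) \<le> \<epsilon>"
    by auto
  have "uniformly_continuous_on K b"
    using insert.prems assms(2) by (auto intro: compact_uniformly_continuous)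
  then obtain \<delta>2 where 2: "\<delta>2 > 0" "\<And>x y. x \<in> K \<Longrightarrow> y \<in> K \<Longrightarrow> dist y x < \<delta>2 \<Longrightarrow> dist (b y) (b x) < \<epsilon>"
    using assms(4) unfolding uniformly_continuous_on_def by metis
  show ?case
    using 1 2 by (intro exI[of _ "min \<delta>1 \<delta>2"]) (force simp: dist_norm norm_minus_commute)
qed

text \<open>Cover, Riemann sum and elimination are combined. The bound on the weights and the fixed
  number \<open>card B\<close> of terms, both independent of \<open>\<epsilon>\<close>, are what the
  later compactness argument requires.\<close>

lemma approximate_bounded_nodes:
  fixes B :: "('a::metric_space \<Rightarrow> complex) set"
  assumes M: "sets M = sets borel" "finite_measure M"
    and K: "compact K" "K \<noteq> {}"
    and B: "finite B" "\<And>b. b \<in> B \<Longrightarrow> continuous_on K b"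
    and cnj: "\<And>b. b \<in> B \<Longrightarrow> (\<lambda>x. cnj (b x)) \<in> cfun.span B"
    and one: "restrict_to K (\<lambda>x. 1) \<in> cfun.span B"
    and "\<epsilon> > 0"
  shows "\<exists>f :: nat \<Rightarrow> 'a \<times> real. (\<forall>i. f i \<in> K \<times> {0..measure M K}) \<and>
    (\<forall>b\<in>B. norm ((LINT x:K|M. b x)
      - (\<Sum>i<card B. complex_of_real (snd (f i)) * b (fst (f i)))) \<le> \<epsilon> * measure M K)"
proof -
  obtain \<delta> where \<delta>: "\<delta> > 0"
    "\<And>b x y. b \<in> B \<Longrightarrow> x \<in> K \<Longrightarrow> y \<in> K \<Longrightarrow> dist y x < \<delta> \<Longrightarrow> norm (b x - b y) \<le> \<epsilon>"
    using uniformly_close_finite_family[OF B(1) K(1) B(2) \<open>\<epsilon> > 0\<close>] by auto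
  obtain C where C: "C \<subseteq> K" "finite C" "K \<subseteq> (\<Union>c\<in>C. ball c \<delta>)"
  proof (rule compactE_image[OF K(1), of K "\<lambda>c. ball c \<delta>"])
    show "K \<subseteq> (\<Union>c\<in>K. ball c \<delta>)" using \<delta>(1) by force
  qed auto
  have Kb: "K \<in> sets borel" using K(1) by (rule borel_compact)
  obtain \<rho> where \<rho>: "\<And>c. c \<in> C \<Longrightarrow> \<rho> c \<ge> 0" "sum \<rho> C = measure M K"
    "\<And>b. b \<in> B \<Longrightarrow> norm ((LINT x:K|M. b x) - (\<Sum>c\<in>C. complex_of_real (\<rho> c) * b c)) \<le> \<epsilon> * measure M K"
    using approximate_on_cover[where B = B, OF M set_integrable_continuous_compact[OF M K(1) B(2)] \<delta>(2)
        C(2,1) Kb order.refl C(3)] by auto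
  obtain D \<sigma> where D: "D \<subseteq> C" "card D \<le> card B" "\<And>c. c \<in> D \<Longrightarrow> \<sigma> c \<ge> (0::real)"
    "\<And>f. f \<in> cfun.span B \<Longrightarrow> (\<Sum>c\<in>D. complex_of_real (\<sigma> c) * f c) = (\<Sum>c\<in>C. complex_of_real (\<rho> c) * f c)"
    using reduce_quadrature[of B C \<rho>, OF B(1) C(2) cnj \<rho>(1)] by blast
  have finD: "finite D" using D(1) C(2) by (rule finite_subset)
  \<comment> \<open>The elimination preserves the value at the restricted constant 1, hence the
    total weight. Being nonnegative, each single weight is then at most
    \<open>measure M K\<close>.\<close>
  have "complex_of_real (sum \<sigma> D) = (\<Sum>c\<in>D. complex_of_real (\<sigma> c) * restrict_to K (\<lambda>x. 1) c)"
    using D(1) C(1) by (auto simp: restrict_to_def intro!: sum.cong)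
  also have "\<dots> = complex_of_real (sum \<rho> C)"
    unfolding D(4)[OF one] using C(1) by (auto simp: restrict_to_def intro!: sum.cong)
  finally have mass: "sum \<sigma> D = measure M K" by (simp only: of_real_eq_iff \<rho>(2))
  obtain h where h: "bij_betw h {0..<card D} D" using ex_bij_betw_nat_finite[OF finD] by blast
  obtain k where k: "k \<in> K" using K(2) by blast
  \<comment> \<open>Padding: all indices from \<open>card D\<close> on carry weight 0 at an
    arbitrary point \<open>k\<close> of \<open>K\<close>, so that every configuration has the same
    index set.\<close>
  define f where "f i = (if i < card D then (h i, \<sigma> (h i)) else (k, 0))" for i
  have hD: "h i \<in> D" if "i < card D" for i using h that by (auto simp: bij_betw_def)
  have "\<sigma> c \<le> measure M K" if "c \<in> D" for c
    using member_le_sum[of c D \<sigma>] that finD D(3) mass by auto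
  then have "f i \<in> K \<times> {0..measure M K}" for i
    using hD[of i] D(1,3) C(1) k by (auto simp: f_def)
  moreover have "norm ((LINT x:K|M. b x)
      - (\<Sum>i<card B. complex_of_real (snd (f i)) * b (fst (f i)))) \<le> \<epsilon> * measure M K" if "b \<in> B" for b
  proof -
    have "(\<Sum>i<card B. complex_of_real (snd (f i)) * b (fst (f i)))
      = (\<Sum>i\<in>{0..<card D}. complex_of_real (\<sigma> (h i)) * b (h i))"
      using D(2) by (intro sum.mono_neutral_cong_right) (auto simp: f_def)
    also have "\<dots> = (\<Sum>c\<in>D. complex_of_real (\<sigma> c) * b c)"
      by (rule sum.reindex_bij_betw[OF h])
    also have "\<dots> = (\<Sum>c\<in>C. complex_of_real (\<rho> c) * b c)"
      using D(4) that by (simp add: cfun.span_base)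
    finally show ?thesis using \<rho>(3)[OF that] by simp
  qed
  ultimately show ?thesis by blast
qed

section \<open>From approximate to exact quadrature by compactness\<close>

text \<open>The total error \<open>g\<close> is continuous on the compact set \<open>S\<close> of
  configurations and takes arbitrarily small values there, so its minimum is 0. Zero weights are
  still allowed at this stage.\<close>

lemma exact_bounded_nodes:
  fixes B :: "('a::metric_space \<Rightarrow> complex) set"
  assumes M: "sets M = sets borel" "finite_measure M"
    and K: "compact K" "K \<noteq> {}"
    and B: "finite B" "\<And>b. b \<in> B \<Longrightarrow> continuous_on K b"
    and cnj: "\<And>b. b \<in> B \<Longrightarrow> (\<lambda>x. cnj (b x)) \<in> cfun.span B"
    and one: "restrict_to K (\<lambda>x. 1) \<in> cfun.span B"
  shows "\<exists>f :: nat \<Rightarrow> 'a \<times> real. (\<forall>i. fst (f i) \<in> K \<and> snd (f i) \<ge> 0) \<and>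
    (\<forall>b\<in>B. (LINT x:K|M. b x) = (\<Sum>i<card B. complex_of_real (snd (f i)) * b (fst (f i))))"
proof -
  define S :: "(nat \<Rightarrow> 'a \<times> real) set" where "S = PiE UNIV (\<lambda>_. K \<times> {0..measure M K})"
  define g where "g f = (\<Sum>b\<in>B. norm ((LINT x:K|M. b x)
      - (\<Sum>i<card B. complex_of_real (snd (f i)) * b (fst (f i)))))" for f :: "nat \<Rightarrow> 'a \<times> real"
  \<comment> \<open>Tychonoff: configurations are infinite sequences under the product topology,
    although \<open>g\<close> reads only the first \<open>card B\<close> entries.\<close>
  have S: "compact S" unfolding S_def compactin_euclidean_iff[symmetric] euclidean_product_topology[symmetric]
    by (simp add: compactin_PiE compact_Times K(1))
  have coord: "continuous_on S (\<lambda>f. f i)" for i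
    by (rule continuous_on_subset[OF continuous_on_product_coordinates]) simp
  have "continuous_on S (\<lambda>f. b (fst (f i)))" if "b \<in> B" for b i
    by (rule continuous_on_compose2[OF B(2)[OF that] continuous_on_fst[OF coord]])
      (auto simp: S_def PiE_def Pi_def mem_Times_iff)
  then have g: "continuous_on S g"
    unfolding g_def by (intro continuous_intros coord) auto
  have approx: "\<exists>f\<in>S. g f \<le> card B * (\<epsilon> * measure M K)" if \<epsilon>: "\<epsilon> > 0" for \<epsilon>
  proof -
    obtain f where f: "\<And>i. f i \<in> K \<times> {0..measure M K}"
      "\<And>b. b \<in> B \<Longrightarrow> norm ((LINT x:K|M. b x)
        - (\<Sum>i<card B. complex_of_real (snd (f i)) * b (fst (f i)))) \<le> \<epsilon> * measure M K"
      using approximate_bounded_nodes[OF assms \<epsilon>] by blast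
    have "f \<in> S" using f(1) by (auto simp: S_def)
    moreover have "g f \<le> card B * (\<epsilon> * measure M K)"
      unfolding g_def using f(2) by (intro sum_bounded_above)
    ultimately show ?thesis by blast
  qed
  then have "S \<noteq> {}" using zero_less_one by blast
  then obtain f where f: "f \<in> S" "\<And>h. h \<in> S \<Longrightarrow> g f \<le> g h"
    using continuous_attains_inf[OF S _ g] by blast
  have "g f \<le> \<epsilon>" if "\<epsilon> > 0" for \<epsilon>
  proof -
    \<comment> \<open>The approximation is invoked at \<open>\<epsilon> / (q + 1)\<close> to absorb
      the factor \<open>q\<close>; the added 1 avoids division by zero when \<open>K\<close> has
      measure 0.\<close>
    define q where "q = card B * measure M K"
    have q: "q \<ge> 0" by (simp add: q_def)
    obtain h where "h \<in> S" "g h \<le> card B * (\<epsilon> / (q + 1) * measure M K)"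
      using approx[of "\<epsilon> / (q + 1)"] q \<open>\<epsilon> > 0\<close> by auto
    moreover have "card B * (\<epsilon> / (q + 1) * measure M K) = \<epsilon> * (q / (q + 1))"
      by (simp add: q_def)
    moreover have "\<epsilon> * (q / (q + 1)) \<le> \<epsilon> * 1"
      using q \<open>\<epsilon> > 0\<close> by (intro mult_left_mono) auto
    ultimately show ?thesis using f(2)[of h] by linarith
  qed
  then have "g f \<le> 0" by (rule field_le_epsilon[of "g f" 0, simplified])
  moreover have "g f \<ge> 0" by (simp add: g_def sum_nonneg)
  ultimately have "g f = 0" by simp
  then have "\<forall>b\<in>B. (LINT x:K|M. b x) = (\<Sum>i<card B. complex_of_real (snd (f i)) * b (fst (f i)))"
    unfolding g_def using B(1) by (subst (asm) sum_nonneg_eq_0_iff) auto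
  moreover have "fst (f i) \<in> K \<and> snd (f i) \<ge> 0" for i
  proof -
    have "f i \<in> K \<times> {0..measure M K}" using f(1) by (auto simp: S_def PiE_def Pi_def)
    then show ?thesis by (auto simp: mem_Times_iff)
  qed
  ultimately show ?thesis by blast
qed

text \<open>Nodes of weight zero are discarded, which is why \<open>N\<close> may fall below
  \<open>card B\<close>, and exactness passes from \<open>B\<close> to its span by
  linearity.\<close>

lemma positive_quadrature:
  fixes B :: "('a::metric_space \<Rightarrow> complex) set"
  assumes M: "sets M = sets borel" "finite_measure M"
    and K: "compact K" "K \<noteq> {}"
    and B: "finite B" "\<And>b. b \<in> B \<Longrightarrow> continuous_on K b"
    and cnj: "\<And>b. b \<in> B \<Longrightarrow> (\<lambda>x. cnj (b x)) \<in> cfun.span B"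
    and one: "restrict_to K (\<lambda>x. 1) \<in> cfun.span B"
  shows "\<exists>N (z :: nat \<Rightarrow> 'a) (\<rho> :: nat \<Rightarrow> real). N \<le> card B \<and>
    (\<forall>i\<in>{1..N}. z i \<in> K \<and> \<rho> i > 0) \<and>
    (\<forall>f\<in>cfun.span B. (LINT x:K|M. f x) = (\<Sum>i=1..N. complex_of_real (\<rho> i) * f (z i)))"
proof -
  obtain f :: "nat \<Rightarrow> 'a \<times> real" where f: "\<And>i. fst (f i) \<in> K" "\<And>i. snd (f i) \<ge> 0"
    "\<And>b. b \<in> B \<Longrightarrow> (LINT x:K|M. b x) = (\<Sum>i<card B. complex_of_real (snd (f i)) * b (fst (f i)))"
    using exact_bounded_nodes[OF assms] by blast
  define I where "I = {i. i < card B \<and> snd (f i) > 0}"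
  define N where "N = card I"
  have finI: "finite I" by (simp add: I_def)
  have N: "N \<le> card B"
    unfolding N_def using card_mono[of "{..<card B}" I] by (auto simp: I_def)
  obtain h where h: "bij_betw h {1..N} I"
    using ex_bij_betw_nat_finite_1[OF finI] by (auto simp: N_def)
  define z where "z i = fst (f (h i))" for i
  define \<rho> where "\<rho> i = snd (f (h i))" for i
  have "h i \<in> I" if "i \<in> {1..N}" for i using h that by (auto simp: bij_betw_def)
  then have pos: "\<forall>i\<in>{1..N}. z i \<in> K \<and> \<rho> i > 0"
    using f(1) by (auto simp: z_def \<rho>_def I_def)
  have B_eq: "(LINT x:K|M. b x) = (\<Sum>i=1..N. complex_of_real (\<rho> i) * b (z i))" if "b \<in> B" for b
  proof -
    have "snd (f i) = 0" if "i < card B" "i \<notin> I" for i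
      using that f(2)[of i] by (auto simp: I_def)
    then have "(\<Sum>i<card B. complex_of_real (snd (f i)) * b (fst (f i)))
      = (\<Sum>i\<in>I. complex_of_real (snd (f i)) * b (fst (f i)))"
      by (intro sum.mono_neutral_right) (auto simp: I_def)
    also have "\<dots> = (\<Sum>i=1..N. complex_of_real (\<rho> i) * b (z i))"
      unfolding z_def \<rho>_def by (rule sum.reindex_bij_betw[OF h, symmetric])
    finally show ?thesis using f(3)[OF that] by simp
  qed
  \<comment> \<open>Integrability is part of \<open>Q\<close> because additivity of the integral,
    and hence closure under sums, depends on it.\<close>
  define Q where "Q = {f. set_integrable M K f \<and>
    (LINT x:K|M. f x) = (\<Sum>i=1..N. complex_of_real (\<rho> i) * f (z i))}"
  have "cfun.subspace Q"
    by (rule cfun_subspaceI)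
      (auto simp: Q_def algebra_simps sum.distrib set_integral_add set_integrable_def[of M K "\<lambda>x. 0"] simp flip: sum_distrib_left)
  moreover have "B \<subseteq> Q"
    using B_eq set_integrable_continuous_compact[OF M K(1) B(2)] by (auto simp: Q_def)
  ultimately have "cfun.span B \<subseteq> Q" by (intro cfun.span_minimal)
  then show ?thesis using N pos by (intro exI[of _ N] exI[of _ z] exI[of _ \<rho>]) (auto simp: Q_def)
qed

section \<open>Mixed polynomials and their restrictions\<close>

text \<open>Restriction is linear, so the preimage of a span is a subspace. This lets a membership
  checked on monomials extend to all mixed polynomials.\<close>

lemma cfun_subspace_restrict_to: "cfun.subspace {f. restrict_to K f \<in> cfun.span B}"
proof (rule cfun_subspaceI)
  show "(\<lambda>x. 0) \<in> {f. restrict_to K f \<in> cfun.span B}"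
    using cfun.span_zero[of B] by (simp add: restrict_to_def zero_fun_def)
next
  fix f g assume "f \<in> {f. restrict_to K f \<in> cfun.span B}" "g \<in> {f. restrict_to K f \<in> cfun.span B}"
  moreover have "restrict_to K (\<lambda>x. f x + g x) = restrict_to K f + restrict_to K g"
    by (auto simp: restrict_to_def fun_eq_iff)
  ultimately show "(\<lambda>x. f x + g x) \<in> {f. restrict_to K f \<in> cfun.span B}"
    by (simp add: cfun.span_add)
next
  fix c f assume "f \<in> {f. restrict_to K f \<in> cfun.span B}"
  moreover have "restrict_to K (\<lambda>x. c * f x) = cscale c (restrict_to K f)"
    by (auto simp: restrict_to_def cscale_def fun_eq_iff)
  ultimately show "(\<lambda>x. c * f x) \<in> {f. restrict_to K f \<in> cfun.span B}"
    by (simp add: cfun.span_scale)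
qed

text \<open>Every single exponent is at most \<open>m\<close>, so the pairs of multi-indices lie in
  a finite box.\<close>

lemma finite_mixed_monomials:
  "finite {mixed_monomial i j :: complex ^ 'd::finite \<Rightarrow> complex | i j.
    (\<Sum>k\<in>UNIV. i k) + (\<Sum>k\<in>UNIV. j k) \<le> m}"
proof -
  let ?F = "PiE UNIV (\<lambda>_. {..m}) :: ('d \<Rightarrow> nat) set"
  have "finite ?F" by (intro finite_PiE) auto
  have in_F: "i \<in> ?F" if "sum i UNIV \<le> m" for i
    using that member_le_sum[of _ UNIV i] by (force intro: order.trans)
  have "{mixed_monomial i j | i j. sum i UNIV + sum j UNIV \<le> m}
      \<subseteq> (\<lambda>(i, j). mixed_monomial i j) ` (?F \<times> ?F)"
    using in_F by (auto simp: image_iff Bex_def) (metis add_leD1 add_leD2)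
  then show ?thesis using \<open>finite ?F\<close> by (meson finite_SigmaI finite_imageI finite_subset)
qed

lemma continuous_on_mixed_polys:
  assumes "p \<in> mixed_polys m"
  shows "continuous_on S p"
proof -
  have "cfun.subspace {p :: complex ^ 'a \<Rightarrow> complex. continuous_on S p}"
    by (rule cfun_subspaceI) (auto intro!: continuous_intros)
  then have "mixed_polys m \<subseteq> {p :: complex ^ 'a \<Rightarrow> complex. continuous_on S p}"
    unfolding mixed_polys_def
    by (intro cfun.span_minimal) (auto simp: mixed_monomial_def[abs_def] intro!: continuous_intros)
  then show ?thesis using assms by auto
qed

text \<open>Conjugating a monomial swaps its two multi-indices and keeps the total degree.\<close>

lemma cnj_mixed_polys:
  assumes "p \<in> mixed_polys m"
  shows "(\<lambda>z. cnj (p z)) \<in> mixed_polys m"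
proof -
  have sub: "cfun.subspace (mixed_polys m)" by (simp add: mixed_polys_def)
  \<comment> \<open>Conjugation is only antilinear, but the preimage is still a complex subspace:
    the scalar \<open>c\<close> merely becomes \<open>cnj c\<close>.\<close>
  have "cfun.subspace {p :: complex ^ 'a \<Rightarrow> complex. (\<lambda>z. cnj (p z)) \<in> mixed_polys m}"
    using cfun.subspace_0[OF sub]
    by (intro cfun_subspaceI) (auto simp: zero_fun_def intro: cfun_subspace_pointwise[OF sub])
  moreover have "(\<lambda>z. cnj (mixed_monomial i j z)) = mixed_monomial j i" for i j :: "'a \<Rightarrow> nat"
    by (simp add: mixed_monomial_def fun_eq_iff mult.commute)
  ultimately have "mixed_polys m \<subseteq> {p :: complex ^ 'a \<Rightarrow> complex. (\<lambda>z. cnj (p z)) \<in> mixed_polys m}"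
    unfolding mixed_polys_def
    by (intro cfun.span_minimal) (auto intro!: cfun.span_base, metis add.commute)
  then show ?thesis using assms by auto
qed

lemma one_mixed_polys: "(\<lambda>z. 1) \<in> mixed_polys m"
proof -
  have "(\<lambda>z. 1) = mixed_monomial (\<lambda>_. 0) (\<lambda>_. 0)" by (simp add: mixed_monomial_def fun_eq_iff)
  then show ?thesis unfolding mixed_polys_def
    by (intro cfun.span_base CollectI exI[of _ "\<lambda>_. 0"]) simp
qed

theorem theorem3p5:
  fixes \<mu> :: "(complex ^ 'd::finite) measure" and K :: "(complex ^ 'd) set" and m :: nat
  assumes "sets \<mu> = sets borel"
    and "finite_measure \<mu>"
    and "K = measure_support \<mu>"
    and "compact K"
    and "m > 0"
  shows "\<exists>(N::nat) (z :: nat \<Rightarrow> complex ^ 'd) (\<rho> :: nat \<Rightarrow> real).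
    N \<le> cfun.dim (restrict_to K ` mixed_polys m) \<and>
    (\<forall>i\<in>{1..N}. z i \<in> K \<and> \<rho> i > 0) \<and>
    (\<forall>p\<in>mixed_polys m. (LINT w:K|\<mu>. p w) = (\<Sum>i=1..N. complex_of_real (\<rho> i) * p (z i)))"
proof (cases "K = {}")
  \<comment> \<open>With no point available as a node, \<open>N = 0\<close> works: the integral over
    the empty set and the empty sum both vanish.\<close>
  case True
  then show ?thesis by (intro exI[of _ 0]) (simp add: set_lebesgue_integral_def)
next
  case False
  let ?G = "{mixed_monomial i j :: complex ^ 'd \<Rightarrow> complex | i j.
    (\<Sum>k\<in>UNIV. i k) + (\<Sum>k\<in>UNIV. j k) \<le> m}"
  let ?V = "restrict_to K ` mixed_polys m :: (complex ^ 'd \<Rightarrow> complex) set"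
  obtain B where B: "B \<subseteq> ?V" "cfun.independent B" "?V \<subseteq> cfun.span B" "card B = cfun.dim ?V"
    using cfun.basis_exists[of ?V] by blast
  have "mixed_polys m \<subseteq> {f. restrict_to K f \<in> cfun.span (restrict_to K ` ?G)}"
    unfolding mixed_polys_def
    by (intro cfun.span_minimal cfun_subspace_restrict_to) (auto intro!: cfun.span_base)
  then have "B \<subseteq> cfun.span (restrict_to K ` ?G)" using B(1) by auto
  \<comment> \<open>Independent vectors in the span of finitely many restricted monomials are finite
    in number; this makes \<open>card B\<close> a genuine count and not the default value 0 of
    infinite sets.\<close>
  then have finB: "finite B"
    using cfun.independent_span_bound[OF finite_imageI[OF finite_mixed_monomials] B(2)] by blast
  \<comment> \<open>Continuity is claimed only relative to \<open>K\<close>, since the extension by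
    zero may jump at the boundary.\<close>
  have cont: "continuous_on K b" if "b \<in> B" for b
  proof -
    obtain p where "p \<in> mixed_polys m" "b = restrict_to K p" using B(1) \<open>b \<in> B\<close> by blast
    then show ?thesis
      using continuous_on_mixed_polys[of p m K] by (simp add: restrict_to_def cong: continuous_on_cong)
  qed
  have cnj: "(\<lambda>x. cnj (b x)) \<in> cfun.span B" if "b \<in> B" for b
  proof -
    obtain p where p: "p \<in> mixed_polys m" "b = restrict_to K p" using B(1) \<open>b \<in> B\<close> by blast
    have "(\<lambda>x. cnj (b x)) = restrict_to K (\<lambda>x. cnj (p x))"
      by (auto simp: p(2) restrict_to_def)
    then show ?thesis using cnj_mixed_polys[OF p(1)] B(3) by auto
  qed
  have one: "restrict_to K (\<lambda>x. 1) \<in> cfun.span B" using B(3) one_mixed_polys by blast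
  obtain N z \<rho> where Q: "N \<le> card B" "\<forall>i\<in>{1..N}. z i \<in> K \<and> \<rho> i > (0::real)"
    "\<And>f. f \<in> cfun.span B \<Longrightarrow> (LINT x:K|\<mu>. f x) = (\<Sum>i=1..N. complex_of_real (\<rho> i) * f (z i))"
    using positive_quadrature[OF assms(1,2,4) False finB cont cnj one] by blast
  have "(LINT w:K|\<mu>. p w) = (\<Sum>i=1..N. complex_of_real (\<rho> i) * p (z i))" if "p \<in> mixed_polys m" for p
  proof -
    \<comment> \<open>Both the integral over \<open>K\<close> and the nodes in \<open>K\<close> see
      only the restriction of \<open>p\<close>, to which the quadrature on the span of
      \<open>B\<close> applies.\<close>
    have "(LINT w:K|\<mu>. p w) = (LINT w:K|\<mu>. restrict_to K p w)"
      unfolding set_lebesgue_integral_def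
      by (intro Bochner_Integration.integral_cong) (auto simp: restrict_to_def indicator_def)
    also have "\<dots> = (\<Sum>i=1..N. complex_of_real (\<rho> i) * restrict_to K p (z i))"
      using B(3) that by (intro Q(3)) auto
    also have "\<dots> = (\<Sum>i=1..N. complex_of_real (\<rho> i) * p (z i))"
      using Q(2) by (intro sum.cong) (auto simp: restrict_to_def)
    finally show ?thesis .
  qed
  then show ?thesis using Q(1,2) B(4) by (intro exI[of _ N] exI[of _ z] exI[of _ \<rho>]) auto
qed

end
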